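(* Consider unilateral link formation with $n$ players and link cost $\alpha>0$ against an adversary. For anonymous disconnection cost and $n\ge 9$, the price of stability is bounded by $1+\frac{8}{n-2}=1+o(1)$, i.e. $$\frac{\min_{S\in \mathrm{NE}(n,\alpha)} C(S)}{\mathrm{OPT}(n,\alpha)}\;\le\; 1+\frac{8}{n-2}\;=\;1+o(1),$$ where $o(1)$ denotes a quantity tending to $0$ as $n\to\infty$, regardless of whether $\alpha$ is fixed or not.
   Context: Players are $V=\{1,\dots,n\}$, link cost is $\alpha>0$. A strategy profile is a matrix $S\in\{0,1\}^{n\times n}$; for $v\ne w$, $S_{vw}=1$ means that player $v$ requests the edge $\{v,w\}$ (diagonal entries play no role and are taken to be $0$). Unilateral link formation: the final graph is the simple undirected graph $G(S)=(V,E(S))$ with $E(S)=\{\{v,w\}: S_{vw}=1 \text{ or } S_{wv}=1\}$. Only essential profiles are considered ($S_{vw}=1\Rightarrow S_{wv}=0$). An adversary assigns to each graph $G=(V,E)$ a probability measure $\Pr_G$ on $E$. For a connected graph $G$, $e\in E$, $v\in V$, the relevance $\mathrm{rel}_G(e,v)$ is the number of vertices that, starting at $v$, can only be reached via $e$ (so it is $0$ iff $e$ is not a bridge). The disconnection cost of $v$ is $I_v(G)=\sum_{e\in E}\mathrm{rel}_G(e,v)\Pr_G(\{e\})$ if $G$ is connected and $I_v(G)=\infty$ otherwise. Disconnection cost is anonymous if for every final graph $G$, every graph automorphism $\phi$ of $G$ and every $v\in V$ we have $I_v(G)=I_{\phi(v)}(G)$. Individual cost: $C_v(S)=\alpha\sum_{w}S_{vw}+I_v(G(S))$.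 Social cost: $C(S)=\sum_{v\in V}C_v(S)$. $\mathrm{OPT}(n,\alpha)$ is the minimum of $C(S)$ over all strategy profiles. $S$ is a Nash equilibrium if no player $v$ can strictly decrease $C_v$ by changing her own row $S_v$ (arbitrarily) while the other rows stay fixed; $\mathrm{NE}(n,\alpha)$ is the set of Nash equilibria. The price of stability (for given $n$ and $\alpha$) is the ratio $\min_{S\in \mathrm{NE}(n,\alpha)} C(S)/\mathrm{OPT}(n,\alpha)$. *)

theory Defs
  imports "HOL-Probability.Probability" "HOL-Library.Landau_Symbols"
begin

definition players :: "nat \<Rightarrow> nat set" where
  "players n = {1..n}"

text \<open>A graph on the vertex set \<open>players n\<close> is represented by its edge set, a subset of the following.\<close>

definition all_edges :: "nat \<Rightarrow> nat set set" where
  "all_edges n = {{v, w} | v w. v \<in> players n \<and> w \<in> players n \<and> v \<noteq> w}"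

text \<open>Strategy profiles are \<open>n \<times> n\<close> matrices over \<open>{0, 1}\<close> with zero diagonal. Entries outside the
  index range are fixed to \<open>0\<close>, so that there are only finitely many profiles for each \<open>n\<close>.\<close>

definition strategy_profiles :: "nat \<Rightarrow> (nat \<Rightarrow> nat \<Rightarrow> nat) set" where
  "strategy_profiles n =
     {S. (\<forall>v w. S v w \<in> {0, 1}) \<and>
         (\<forall>v w. S v w = 1 \<longrightarrow> v \<in> players n \<and> w \<in> players n \<and> v \<noteq> w)}"

definition essential_profiles :: "nat \<Rightarrow> (nat \<Rightarrow> nat \<Rightarrow> nat) set" where
  "essential_profiles n = {S \<in> strategy_profiles n. \<forall>v w. S v w = 1 \<longrightarrow> S w v = 0}"

text \<open>Unilateral link formation: a request by one endpoint suffices.\<close>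

definition final_graph :: "nat \<Rightarrow> (nat \<Rightarrow> nat \<Rightarrow> nat) \<Rightarrow> nat set set" where
  "final_graph n S =
     {{v, w} | v w. v \<in> players n \<and> w \<in> players n \<and> v \<noteq> w \<and> (S v w = 1 \<or> S w v = 1)}"

fun walk_edges :: "'a list \<Rightarrow> 'a set list" where
  "walk_edges (x # y # zs) = {x, y} # walk_edges (y # zs)"
| "walk_edges _ = []"

definition walk_betw :: "'a set \<Rightarrow> 'a set set \<Rightarrow> 'a \<Rightarrow> 'a list \<Rightarrow> 'a \<Rightarrow> bool" where
  "walk_betw V E v p w \<longleftrightarrow>
     p \<noteq> [] \<and> hd p = v \<and> last p = w \<and> set p \<subseteq> V \<and> set (walk_edges p) \<subseteq> E"

definition connected_graph :: "'a set \<Rightarrow> 'a set set \<Rightarrow> bool" where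
  "connected_graph V E \<longleftrightarrow> (\<forall>v\<in>V. \<forall>w\<in>V. \<exists>p. walk_betw V E v p w)"

text \<open>The relevance is only meaningful for connected graphs, and only used for them.\<close>

definition relevance :: "'a set \<Rightarrow> 'a set set \<Rightarrow> 'a set \<Rightarrow> 'a \<Rightarrow> nat" where
  "relevance V E e v = card {w \<in> V. \<forall>p. walk_betw V E v p w \<longrightarrow> e \<in> set (walk_edges p)}"

definition graph_automorphism :: "'a set \<Rightarrow> 'a set set \<Rightarrow> ('a \<Rightarrow> 'a) \<Rightarrow> bool" where
  "graph_automorphism V E \<phi> \<longleftrightarrow>
     bij_betw \<phi> V V \<and> (\<forall>v\<in>V. \<forall>w\<in>V. {v, w} \<in> E \<longleftrightarrow> {\<phi> v, \<phi> w} \<in> E)"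

text \<open>A probability measure on the finite set \<open>E\<close> (with all subsets measurable) is a \<open>pmf\<close> with
  support in \<open>E\<close>. There is none for \<open>E = {}\<close>, so edgeless graphs are exempted; they are
  disconnected as soon as there are two players.\<close>

definition adversary :: "nat \<Rightarrow> (nat set set \<Rightarrow> nat set pmf) \<Rightarrow> bool" where
  "adversary n A \<longleftrightarrow> (\<forall>E. E \<subseteq> all_edges n \<and> E \<noteq> {} \<longrightarrow> set_pmf (A E) \<subseteq> E)"

definition disconnection_cost ::
  "nat \<Rightarrow> (nat set set \<Rightarrow> nat set pmf) \<Rightarrow> nat set set \<Rightarrow> nat \<Rightarrow> ereal" where
  "disconnection_cost n A E v =
     (if connected_graph (players n) E
      then ereal (\<Sum>e\<in>E. real (relevance (players n) E e v) * measure_pmf.prob (A E) {e})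
      else \<infinity>)"

definition anonymous :: "nat \<Rightarrow> (nat set set \<Rightarrow> nat set pmf) \<Rightarrow> bool" where
  "anonymous n A \<longleftrightarrow>
     (\<forall>S\<in>essential_profiles n. \<forall>\<phi>. graph_automorphism (players n) (final_graph n S) \<phi> \<longrightarrow>
        (\<forall>v\<in>players n. disconnection_cost n A (final_graph n S) v =
                       disconnection_cost n A (final_graph n S) (\<phi> v)))"

definition individual_cost ::
  "nat \<Rightarrow> real \<Rightarrow> (nat set set \<Rightarrow> nat set pmf) \<Rightarrow> (nat \<Rightarrow> nat \<Rightarrow> nat) \<Rightarrow> nat \<Rightarrow> ereal" where
  "individual_cost n \<alpha> A S v =
     ereal (\<alpha> * (\<Sum>w\<in>players n. real (S v w))) + disconnection_cost n A (final_graph n S) v"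

definition social_cost ::
  "nat \<Rightarrow> real \<Rightarrow> (nat set set \<Rightarrow> nat set pmf) \<Rightarrow> (nat \<Rightarrow> nat \<Rightarrow> nat) \<Rightarrow> ereal" where
  "social_cost n \<alpha> A S = (\<Sum>v\<in>players n. individual_cost n \<alpha> A S v)"

definition OPT :: "nat \<Rightarrow> real \<Rightarrow> (nat set set \<Rightarrow> nat set pmf) \<Rightarrow> ereal" where
  "OPT n \<alpha> A = Min (social_cost n \<alpha> A ` strategy_profiles n)"

text \<open>Equilibria are essential profiles, but a deviating player may choose any row \<open>r\<close>, including
  one that makes the resulting profile non-essential.\<close>

definition NE :: "nat \<Rightarrow> real \<Rightarrow> (nat set set \<Rightarrow> nat set pmf) \<Rightarrow> (nat \<Rightarrow> nat \<Rightarrow> nat) set" where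
  "NE n \<alpha> A =
     {S \<in> essential_profiles n. \<forall>v\<in>players n. \<forall>r. S(v := r) \<in> strategy_profiles n \<longrightarrow>
        \<not> individual_cost n \<alpha> A (S(v := r)) v < individual_cost n \<alpha> A S v}"

definition price_of_stability :: "nat \<Rightarrow> real \<Rightarrow> (nat set set \<Rightarrow> nat set pmf) \<Rightarrow> ereal" where
  "price_of_stability n \<alpha> A = Min (social_cost n \<alpha> A ` NE n \<alpha> A) / OPT n \<alpha> A"

text \<open>The minima range over finite sets, and \<open>OPT\<close> is positive and finite for \<open>n \<ge> 2\<close>, so the
  quotient above never falls back on a default value of \<open>Min\<close> or of \<open>ereal\<close> division, provided
  there is an equilibrium.\<close>

lemma finite_strategy_profiles: "finite (strategy_profiles n)"
proof -
  define f :: "(nat \<times> nat) set \<Rightarrow> nat \<Rightarrow> nat \<Rightarrow> nat"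
    where "f X v w = of_bool ((v, w) \<in> X)" for X v w
  have "strategy_profiles n \<subseteq> f ` Pow (players n \<times> players n)"
  proof
    fix S assume S: "S \<in> strategy_profiles n"
    have "S = f {(v, w). S v w = 1}"
    proof (intro ext)
      fix v w
      have "S v w = 0 \<or> S v w = 1" using S by (auto simp: strategy_profiles_def)
      thus "S v w = f {(v, w). S v w = 1} v w" by (auto simp: f_def)
    qed
    moreover have "{(v, w). S v w = 1} \<subseteq> players n \<times> players n"
      using S by (auto simp: strategy_profiles_def)
    ultimately show "S \<in> f ` Pow (players n \<times> players n)" by blast
  qed
  thus ?thesis by (rule finite_subset) (simp add: players_def)
qed

lemma finite_NE: "finite (NE n \<alpha> A)"
  by (rule finite_subset[OF _ finite_strategy_profiles[of n]])
     (auto simp: NE_def essential_profiles_def)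

lemma disconnection_cost_nonneg: "0 \<le> disconnection_cost n A E v"
  by (auto simp: disconnection_cost_def intro!: sum_nonneg mult_nonneg_nonneg)

lemma individual_cost_nonneg: "0 \<le> \<alpha> \<Longrightarrow> 0 \<le> individual_cost n \<alpha> A S v"
  unfolding individual_cost_def
  by (intro add_nonneg_nonneg disconnection_cost_nonneg) (auto intro!: mult_nonneg_nonneg sum_nonneg)

lemma social_cost_pos:
  assumes "n \<ge> 2" "\<alpha> > 0"
  shows "0 < social_cost n \<alpha> A S"
proof -
  have "\<exists>v\<in>players n. 0 < individual_cost n \<alpha> A S v"
  proof (cases "connected_graph (players n) (final_graph n S)")
    case False
    have "1 \<in> players n" using assms by (auto simp: players_def)
    with False show ?thesis
      by (intro bexI[of _ 1]) (auto simp: individual_cost_def disconnection_cost_def)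
  next
    case True
    have "1 \<in> players n" "2 \<in> players n" using assms by (auto simp: players_def)
    then obtain p where p: "walk_betw (players n) (final_graph n S) 1 p 2"
      using True by (auto simp: connected_graph_def)
    then obtain x y zs where "p = x # y # zs"
      by (cases p rule: walk_edges.cases) (auto simp: walk_betw_def)
    with p have "{x, y} \<in> final_graph n S" by (auto simp: walk_betw_def)
    then obtain v w where vw: "v \<in> players n" "w \<in> players n" "S v w = 1"
      by (auto simp: final_graph_def doubleton_eq_iff)
    have "(0::real) < (\<Sum>w\<in>players n. real (S v w))"
      using vw by (intro sum_pos2[of _ w]) (auto simp: players_def)
    hence "0 < ereal (\<alpha> * (\<Sum>w\<in>players n. real (S v w)))" using assms by simp
    hence "0 < individual_cost n \<alpha> A S v"
      unfolding individual_cost_def by (intro add_pos_nonneg disconnection_cost_nonneg)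
    with vw show ?thesis by blast
  qed
  then obtain v where v: "v \<in> players n" "0 < individual_cost n \<alpha> A S v" by blast
  have "individual_cost n \<alpha> A S v \<le> social_cost n \<alpha> A S"
    unfolding social_cost_def using v assms
    by (subst sum.remove[of _ v])
       (auto simp: players_def intro!: add_increasing2 sum_nonneg individual_cost_nonneg)
  with v show ?thesis by simp
qed

lemma social_cost_finite:
  assumes "connected_graph (players n) (final_graph n S)"
  shows "social_cost n \<alpha> A S < \<infinity>"
  using assms by (simp add: social_cost_def individual_cost_def disconnection_cost_def)

lemma OPT_pos_finite:
  assumes "n \<ge> 2" "\<alpha> > 0"
  shows "0 < OPT n \<alpha> A" "OPT n \<alpha> A < \<infinity>"
proof -
  define S :: "nat \<Rightarrow> nat \<Rightarrow> nat" where "S v w = of_bool (v = 1 \<and> w \<in> {2..n})" for v w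
  have S: "S \<in> strategy_profiles n"
    using assms by (auto simp: S_def strategy_profiles_def players_def)
  have E: "{1, w} \<in> final_graph n S" if "w \<in> players n" "w \<noteq> 1" for w
  proof -
    have "1 \<in> players n" "S 1 w = 1" using that assms by (auto simp: S_def players_def)
    with that show ?thesis unfolding final_graph_def by blast
  qed
  have E': "{w, 1} \<in> final_graph n S" if "w \<in> players n" "w \<noteq> 1" for w
    using E[OF that] by (simp add: insert_commute)
  have 1: "1 \<in> players n" using assms by (auto simp: players_def)
  have "connected_graph (players n) (final_graph n S)"
    unfolding connected_graph_def
  proof (intro ballI)
    fix v w assume vw: "v \<in> players n" "w \<in> players n"
    define p where "p = (if v = w then [v] else if v = 1 then [1, w] else if w = 1 then [v, 1]
                         else [v, 1, w])"
    have "walk_betw (players n) (final_graph n S) v p w"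
      using vw 1 E E' by (auto simp: walk_betw_def p_def)
    thus "\<exists>p. walk_betw (players n) (final_graph n S) v p w" ..
  qed
  hence "social_cost n \<alpha> A S < \<infinity>" by (rule social_cost_finite)
  moreover have "OPT n \<alpha> A \<le> social_cost n \<alpha> A S"
    unfolding OPT_def using S finite_strategy_profiles[of n] by (intro Min_le) auto
  ultimately show "OPT n \<alpha> A < \<infinity>" by (rule le_less_trans[rotated])
  have "OPT n \<alpha> A \<in> social_cost n \<alpha> A ` strategy_profiles n"
    unfolding OPT_def using S finite_strategy_profiles[of n] by (intro Min_in) auto
  thus "0 < OPT n \<alpha> A" using social_cost_pos[OF assms] by auto
qed

end

theory Submission
  imports Defs "HOL-Real_Asymp.Real_Asymp"
begin

text \<open>A connected graph with \<open>n - 1\<close> edges consists of bridges, each of total relevance at least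
  \<open>2 (n - 1)\<close>; hence \<open>OPT \<ge> min (n \<alpha>) ((n - 1) (\<alpha> + 2))\<close>. If \<open>\<alpha> \<le> n / 2\<close>, the cycle in which
  everybody buys one edge is an equilibrium of cost \<open>n \<alpha>\<close>: a player who drops her edge becomes the
  end of a path, and by the reflection of the path and anonymity her disconnection cost is at least
  \<open>n / 2\<close>. If \<open>\<alpha> > n / 2\<close>, the star paid for by its center is an equilibrium, since by anonymity
  the disconnection cost of a leaf is at most \<open>2 < \<alpha>\<close>; its cost is at most \<open>(n - 1) (\<alpha> + 2)\<close>.\<close>

section \<open>Connectivity and cuts\<close>

text \<open>Cuts take the place of walks: connectivity is later proved and refuted through vertex
  sets that no edge leaves.\<close>

definition crossed :: "'a set \<Rightarrow> 'a set set \<Rightarrow> 'a set \<Rightarrow> bool" where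
  "crossed V E X \<longleftrightarrow> (\<exists>a\<in>X. \<exists>b\<in>V - X. {a, b} \<in> E)"

text \<open>The first step of the walk that leaves \<open>X\<close> is such an edge.\<close>

lemma walk_edges_crossing:
  assumes "p \<noteq> []" "hd p \<in> X" "last p \<notin> X"
  shows "\<exists>a\<in>X. \<exists>b\<in>set p - X. {a, b} \<in> set (walk_edges p)"
  using assms
proof (induction p rule: walk_edges.induct)
  case (1 x y zs)
  show ?case
  proof (cases "y \<in> X")
    case True
    with 1 have "\<exists>a\<in>X. \<exists>b\<in>set (y # zs) - X. {a, b} \<in> set (walk_edges (y # zs))" by simp
    then show ?thesis by auto
  next
    case False
    with 1 show ?thesis by (intro bexI[of _ x] bexI[of _ y]) auto
  qed
qed auto

lemma walk_edges_snoc: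
  "p \<noteq> [] \<Longrightarrow> walk_edges (p @ [b]) = walk_edges p @ [{last p, b}]"
  by (induction p rule: walk_edges.induct) auto

lemma walk_betw_snoc:
  assumes "walk_betw V E v p a" "{a, b} \<in> E" "b \<in> V"
  shows "walk_betw V E v (p @ [b]) b"
  using assms by (auto simp: walk_betw_def walk_edges_snoc)

text \<open>A walk between the two sides of a cut crosses it. Conversely, no edge leaves the set of
  vertices reachable from \<open>v\<close>, so this set must be all of \<open>V\<close>.\<close>

lemma connected_graph_iff_crossed:
  "connected_graph V E \<longleftrightarrow> (\<forall>X. X \<subseteq> V \<and> X \<noteq> {} \<and> X \<noteq> V \<longrightarrow> crossed V E X)"
proof (intro iffI allI impI)
  fix X assume "connected_graph V E" and X: "X \<subseteq> V \<and> X \<noteq> {} \<and> X \<noteq> V"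
  moreover from X obtain v w where "v \<in> X" "v \<in> V" "w \<in> V" "w \<notin> X" by blast
  ultimately obtain p where "walk_betw V E v p w"
    unfolding connected_graph_def by blast
  with \<open>v \<in> X\<close> \<open>w \<notin> X\<close> show "crossed V E X"
    using walk_edges_crossing[of p X] unfolding walk_betw_def crossed_def by blast
next
  assume *: "\<forall>X. X \<subseteq> V \<and> X \<noteq> {} \<and> X \<noteq> V \<longrightarrow> crossed V E X"
  show "connected_graph V E"
    unfolding connected_graph_def
  proof (intro ballI)
    fix v w assume vw: "v \<in> V" "w \<in> V"
    define X where "X = {u \<in> V. \<exists>p. walk_betw V E v p u}"
    have "walk_betw V E v [v] v" using vw by (simp add: walk_betw_def)
    then have "v \<in> X" using vw by (auto simp: X_def)
    moreover have "\<not> crossed V E X"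
      using walk_betw_snoc unfolding crossed_def X_def by fast
    moreover have "X \<subseteq> V" by (auto simp: X_def)
    ultimately have "X = V" using * by blast
    with vw show "\<exists>p. walk_betw V E v p w" unfolding X_def by blast
  qed
qed

lemma crossed_mono: "crossed V E X \<Longrightarrow> E \<subseteq> F \<Longrightarrow> crossed V F X"
  unfolding crossed_def by blast

lemma connected_graph_mono: "connected_graph V E \<Longrightarrow> E \<subseteq> F \<Longrightarrow> connected_graph V F"
  unfolding connected_graph_iff_crossed using crossed_mono by metis

text \<open>A set of vertices is grown from a single vertex; each new vertex is attached by a
  crossing edge, which did not lie inside the set before.\<close>

lemma connected_graph_card_edges:
  assumes "connected_graph V E" "finite V" "finite E"
  shows "card V \<le> card E + 1"
proof (cases "V = {}")
  case False
  have "\<exists>X\<subseteq>V. card X = Suc k \<and> k \<le> card {e \<in> E. e \<subseteq> X}" if "Suc k \<le> card V" for k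
    using that
  proof (induction k)
    case 0
    from False obtain v where "v \<in> V" by blast
    then show ?case by (intro exI[of _ "{v}"]) auto
  next
    case (Suc k)
    then obtain X where X: "X \<subseteq> V" "card X = Suc k" "k \<le> card {e \<in> E. e \<subseteq> X}" by auto
    have "X \<noteq> {}" "X \<noteq> V" using X Suc by auto
    with assms(1) X have "crossed V E X" by (simp add: connected_graph_iff_crossed)
    then obtain a b where ab: "a \<in> X" "b \<in> V" "b \<notin> X" "{a, b} \<in> E"
      unfolding crossed_def by blast
    have "finite X" using X assms(2) finite_subset by blast
    have "insert {a, b} {e \<in> E. e \<subseteq> X} \<subseteq> {e \<in> E. e \<subseteq> insert b X}" using ab by auto
    from card_mono[OF _ this] have "Suc k \<le> card {e \<in> E. e \<subseteq> insert b X}"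
      using X ab assms(3) by (simp add: card_insert_if)
    with X ab \<open>finite X\<close> show ?case by (intro exI[of _ "insert b X"]) auto
  qed
  from this[of "card V - 1"] obtain X where "card V - 1 \<le> card {e \<in> E. e \<subseteq> X}"
    using False assms(2) by (auto simp: card_gt_0_iff Suc_le_eq)
  also have "\<dots> \<le> card E" using assms(3) by (intro card_mono) auto
  finally show ?thesis by simp
qed simp

section \<open>Relevance of an edge and cuts\<close>

text \<open>No edge but \<open>e\<close> leads from \<open>X\<close> to \<open>V - X\<close>, so
  every walk from \<open>v\<close> to a vertex of \<open>V - X\<close> uses \<open>e\<close>, and
  all of \<open>V - X\<close> counts.\<close>

lemma relevance_ge_cut:
  assumes "finite V" "v \<in> X" "\<And>a b. a \<in> X \<Longrightarrow> b \<in> V - X \<Longrightarrow> {a, b} \<in> E \<Longrightarrow> {a, b} = e"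
  shows "card (V - X) \<le> relevance V E e v"
proof -
  have "e \<in> set (walk_edges p)" if w: "w \<in> V - X" and p: "walk_betw V E v p w" for w p
  proof -
    obtain a b where "a \<in> X" "b \<in> set p - X" "{a, b} \<in> set (walk_edges p)"
      using walk_edges_crossing[of p X] w p assms(2) by (auto simp: walk_betw_def)
    with p assms(3)[of a b] show ?thesis by (auto simp: walk_betw_def subset_iff)
  qed
  then show ?thesis unfolding relevance_def using assms(1) by (intro card_mono) auto
qed

lemma relevance_eq_0:
  assumes "connected_graph V (E - {e})" "v \<in> V"
  shows "relevance V E e v = 0"
proof -
  have "\<exists>p. walk_betw V E v p w \<and> e \<notin> set (walk_edges p)" if "w \<in> V" for w
  proof -
    obtain p where "walk_betw V (E - {e}) v p w"
      using assms \<open>w \<in> V\<close> unfolding connected_graph_def by blast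
    then show ?thesis unfolding walk_betw_def by blast
  qed
  then have "{w \<in> V. \<forall>p. walk_betw V E v p w \<longrightarrow> e \<in> set (walk_edges p)} = {}" by blast
  then show ?thesis by (simp only: relevance_def card.empty)
qed

text \<open>With \<open>k + 1\<close> and \<open>l + 1\<close> elements on the two sides,
  \<open>(k + 1) * (l + 1) \<ge> k + l + 1\<close>.\<close>

lemma card_mult_card_compl_ge:
  assumes "finite V" "X \<subseteq> V" "X \<noteq> {}" "X \<noteq> V"
  shows "card V - 1 \<le> card X * card (V - X)"
proof -
  have "finite X" using assms finite_subset by blast
  then have "card X \<ge> 1" using assms by (simp add: card_gt_0_iff Suc_le_eq)
  moreover have "card (V - X) \<ge> 1" using assms by (auto simp: card_gt_0_iff Suc_le_eq)
  ultimately obtain k l where "card X = Suc k" "card (V - X) = Suc l"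
    by (metis One_nat_def Suc_le_D)
  moreover have "card V = card X + card (V - X)"
    using assms \<open>finite X\<close> by (metis card_Diff_subset card_mono le_add_diff_inverse)
  ultimately show ?thesis by simp
qed

text \<open>Without \<open>e\<close> there are too few edges for connectivity, so some cut
  \<open>X\<close> is crossed by no other edge. Each vertex then loses at least the opposite side,
  which makes \<open>2 * card X * card (V - X)\<close> in total.\<close>

lemma sum_relevance_tree_edge:
  assumes "finite V" "finite E" "card E + 1 = card V" "e \<in> E"
  shows "2 * (card V - 1) \<le> (\<Sum>v\<in>V. relevance V E e v)"
proof -
  have "card (E - {e}) + 1 < card V"
    using assms by (metis One_nat_def Suc_eq_plus1 card_Suc_Diff1 lessI)
  then have "\<not> connected_graph V (E - {e})"
    using connected_graph_card_edges[of V "E - {e}"] assms by auto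
  then obtain X where X: "X \<subseteq> V" "X \<noteq> {}" "X \<noteq> V" "\<not> crossed V (E - {e}) X"
    unfolding connected_graph_iff_crossed by blast
  have *: "{a, b} = e" if "a \<in> X" "b \<in> V - X" "{a, b} \<in> E" for a b
    using X(4) that unfolding crossed_def by blast
  have 1: "card (V - X) \<le> relevance V E e v" if "v \<in> X" for v
    using relevance_ge_cut[of V v X E e] that * assms(1) by blast
  \<comment> \<open>The same cut seen from its other side, where the lost vertices are those of
    \<open>X\<close>.\<close>
  have 2: "card X \<le> relevance V E e v" if "v \<in> V - X" for v
  proof -
    have "card (V - (V - X)) \<le> relevance V E e v"
      using *[of b a for a b] that assms(1)
      by (intro relevance_ge_cut) (auto simp: insert_commute)
    with X show ?thesis by (simp add: double_diff)
  qed
  have "2 * (card V - 1) \<le> card X * card (V - X) + card (V - X) * card X"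
    using card_mult_card_compl_ge[OF assms(1) X(1-3)] by (simp add: mult.commute)
  also have "\<dots> \<le> (\<Sum>v\<in>X. relevance V E e v) + (\<Sum>v\<in>V - X. relevance V E e v)"
    using sum_bounded_below[of X "card (V - X)" "relevance V E e"]
      sum_bounded_below[of "V - X" "card X" "relevance V E e"] 1 2 by (intro add_mono) auto
  also have "\<dots> = (\<Sum>v\<in>V. relevance V E e v)"
    using sum.subset_diff[OF X(1) assms(1), of "relevance V E e"] by simp
  finally show ?thesis .
qed

section \<open>Costs\<close>

lemma finite_players [simp]: "finite (players n)" and card_players [simp]: "card (players n) = n"
  by (auto simp: players_def)

lemma finite_all_edges: "finite (all_edges n)"
  by (rule finite_subset[of _ "Pow (players n)"]) (auto simp: all_edges_def)

lemma final_graph_subset: "final_graph n S \<subseteq> all_edges n"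
  unfolding final_graph_def all_edges_def by blast

lemma finite_final_graph [simp]: "finite (final_graph n S)"
  using finite_subset[OF final_graph_subset finite_all_edges] .

lemma sum_adversary_prob:
  assumes "adversary n A" "E \<subseteq> all_edges n" "E \<noteq> {}"
  shows "(\<Sum>e\<in>E. measure_pmf.prob (A E) {e}) = 1"
proof -
  have "finite E" using assms(2) finite_all_edges finite_subset by blast
  then show ?thesis
    using sum_pmf_eq_1[of E "A E"] assms unfolding adversary_def by (simp add: pmf.rep_eq)
qed

lemma connected_graph_nonempty:
  assumes "connected_graph (players n) E" "n \<ge> 2"
  shows "E \<noteq> {}"
  using connected_graph_card_edges[OF assms(1)] assms(2) by auto

lemma strategy_profileD:
  assumes "S \<in> strategy_profiles n"
  shows "S v w \<in> {0, 1}" "S v w = 1 \<Longrightarrow> v \<in> players n \<and> w \<in> players n \<and> v \<noteq> w"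
  using assms unfolding strategy_profiles_def by blast+

text \<open>The disconnection costs of all players with the two sums exchanged: an average over the
  attacked edge, so that bounds on the total relevance of single edges carry over. This real number
  agrees with the sum of the costs only for connected graphs.\<close>

definition total_disconnection :: "nat \<Rightarrow> (nat set set \<Rightarrow> nat set pmf) \<Rightarrow> nat set set \<Rightarrow> real" where
  "total_disconnection n A E =
     (\<Sum>e\<in>E. real (\<Sum>v\<in>players n. relevance (players n) E e v) * measure_pmf.prob (A E) {e})"

lemma sum_disconnection_cost:
  assumes "connected_graph (players n) E"
  shows "(\<Sum>v\<in>players n. disconnection_cost n A E v) = ereal (total_disconnection n A E)"
proof -
  have "(\<Sum>v\<in>players n. disconnection_cost n A E v) = ereal (\<Sum>v\<in>players n.
      \<Sum>e\<in>E. real (relevance (players n) E e v) * measure_pmf.prob (A E) {e})"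
    using assms by (simp add: disconnection_cost_def)
  also have "(\<Sum>v\<in>players n. \<Sum>e\<in>E. real (relevance (players n) E e v)
      * measure_pmf.prob (A E) {e}) = total_disconnection n A E"
    unfolding total_disconnection_def of_nat_sum sum_distrib_right by (rule sum.swap)
  finally show ?thesis .
qed

lemma social_cost_eq:
  assumes "connected_graph (players n) (final_graph n S)"
  shows "social_cost n \<alpha> A S =
    ereal (\<alpha> * real (\<Sum>v\<in>players n. \<Sum>w\<in>players n. S v w)
      + total_disconnection n A (final_graph n S))"
proof -
  have "social_cost n \<alpha> A S =
      (\<Sum>v\<in>players n. ereal (\<alpha> * (\<Sum>w\<in>players n. real (S v w))))
      + (\<Sum>v\<in>players n. disconnection_cost n A (final_graph n S) v)"
    by (simp add: social_cost_def individual_cost_def sum.distrib)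
  also have "\<dots> = ereal (\<alpha> * real (\<Sum>v\<in>players n. \<Sum>w\<in>players n. S v w))
      + ereal (total_disconnection n A (final_graph n S))"
    by (simp only: sum_disconnection_cost[OF assms] sum_ereal sum_distrib_left of_nat_sum)
  finally show ?thesis by simp
qed

lemma total_disconnection_nonneg: "0 \<le> total_disconnection n A E"
  unfolding total_disconnection_def
  by (intro sum_nonneg mult_nonneg_nonneg) (auto intro: sum_nonneg)

lemma total_disconnection_tree:
  assumes "adversary n A" "E \<subseteq> all_edges n" "card E + 1 = n" "n \<ge> 2"
  shows "2 * (real n - 1) \<le> total_disconnection n A E"
proof -
  have fin: "finite E" using assms(2) finite_all_edges finite_subset by blast
  have "E \<noteq> {}" using assms by auto
  then have "(\<Sum>e\<in>E. measure_pmf.prob (A E) {e}) = 1"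
    using sum_adversary_prob assms by blast
  then have "2 * (real n - 1) = (\<Sum>e\<in>E. 2 * (real n - 1) * measure_pmf.prob (A E) {e})"
    by (simp flip: sum_distrib_left)
  also have "\<dots> \<le> total_disconnection n A E"
    unfolding total_disconnection_def
  proof (intro sum_mono mult_right_mono)
    fix e assume "e \<in> E"
    then have "2 * (n - 1) \<le> (\<Sum>v\<in>players n. relevance (players n) E e v)"
      using sum_relevance_tree_edge[of "players n" E e] fin assms by simp
    then have "real (2 * (n - 1)) \<le> real (\<Sum>v\<in>players n. relevance (players n) E e v)"
      by (simp only: of_nat_le_iff)
    then show "2 * (real n - 1) \<le> real (\<Sum>v\<in>players n. relevance (players n) E e v)"
      using assms by (simp add: of_nat_diff)
  qed auto
  finally show ?thesis .
qed

section \<open>The lower bound on the optimal social cost\<close>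

text \<open>Each edge stems from a request, but in a profile that is not essential two requests may
  yield the same edge, whence only an inequality. The optimum ranges over such profiles too.\<close>

lemma card_final_graph_le:
  assumes "S \<in> strategy_profiles n"
  shows "card (final_graph n S) \<le> (\<Sum>v\<in>players n. \<Sum>w\<in>players n. S v w)"
proof -
  let ?R = "{p \<in> players n \<times> players n. S (fst p) (snd p) = 1}"
  have 01: "S v w = of_bool (S v w = 1)" for v w
    using strategy_profileD(1)[OF assms, of v w] by auto
  have "final_graph n S \<subseteq> (\<lambda>p. {fst p, snd p}) ` ?R"
  proof
    fix e assume "e \<in> final_graph n S"
    then obtain v w where "v \<in> players n" "w \<in> players n" "S v w = 1" "e = {v, w}"
      unfolding final_graph_def by (auto simp: insert_commute)
    then show "e \<in> (\<lambda>p. {fst p, snd p}) ` ?R" by (intro image_eqI[of _ _ "(v, w)"]) auto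
  qed
  then have "card (final_graph n S) \<le> card ?R"
    by (rule surj_card_le[rotated]) simp
  also have "card ?R = (\<Sum>p\<in>players n \<times> players n. of_bool (S (fst p) (snd p) = 1))"
    by (simp add: Int_def)
  also have "\<dots> = (\<Sum>p\<in>players n \<times> players n. S (fst p) (snd p))"
    by (intro sum.cong refl) (metis 01)
  also have "\<dots> = (\<Sum>v\<in>players n. \<Sum>w\<in>players n. S v w)"
    by (simp add: sum.cartesian_product case_prod_beta)
  finally show ?thesis .
qed

text \<open>A connected final graph with \<open>n - 1\<close> edges pays for at least
  \<open>n - 1\<close> links and for a total relevance of at least \<open>2 * (n - 1)\<close>,
  whichever edge is hit. One with more edges pays for at least \<open>n\<close> links, and a
  disconnected one has infinite cost.\<close>

lemma social_cost_ge:
  assumes "adversary n A" "\<alpha> > 0" "n \<ge> 2" "S \<in> strategy_profiles n"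
  shows "ereal (min (real n * \<alpha>) ((real n - 1) * (\<alpha> + 2))) \<le> social_cost n \<alpha> A S"
proof (cases "connected_graph (players n) (final_graph n S)")
  case False
  have "players n \<noteq> {}" using assms by (auto simp: players_def)
  with False have "social_cost n \<alpha> A S = \<infinity>"
    by (auto simp: social_cost_def individual_cost_def disconnection_cost_def sum_Pinfty)
  then show ?thesis by simp
next
  case True
  let ?E = "final_graph n S" and ?m = "\<Sum>v\<in>players n. \<Sum>w\<in>players n. S v w"
  have m: "card ?E \<le> ?m" using card_final_graph_le assms by blast
  have E: "n \<le> card ?E + 1"
    using connected_graph_card_edges[OF True] by simp
  have "min (real n * \<alpha>) ((real n - 1) * (\<alpha> + 2)) \<le> \<alpha> * real ?m + total_disconnection n A ?E"
  proof (cases "card ?E + 1 = n")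
    case True
    then have "real n - 1 \<le> real ?m" using m by linarith
    then have "\<alpha> * (real n - 1) \<le> \<alpha> * real ?m" using assms by (intro mult_left_mono) auto
    moreover have "2 * (real n - 1) \<le> total_disconnection n A ?E"
      using total_disconnection_tree True assms final_graph_subset by blast
    moreover have "(real n - 1) * (\<alpha> + 2) = \<alpha> * (real n - 1) + 2 * (real n - 1)"
      by (simp add: algebra_simps)
    ultimately show ?thesis by linarith
  next
    case False
    then have "real n \<le> real ?m" using E m by linarith
    then have "\<alpha> * real n \<le> \<alpha> * real ?m" using assms by (intro mult_left_mono) auto
    then show ?thesis using total_disconnection_nonneg[of n A ?E] by (simp add: mult.commute)
  qed
  then show ?thesis by (simp only: social_cost_eq[OF True] ereal_less_eq)
qed

lemma OPT_ge:
  assumes "adversary n A" "\<alpha> > 0" "n \<ge> 2"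
  shows "ereal (min (real n * \<alpha>) ((real n - 1) * (\<alpha> + 2))) \<le> OPT n \<alpha> A"
proof -
  \<comment> \<open>\<open>Min\<close> has its meaning only on a nonempty set; the profile without
    requests is a witness.\<close>
  have "(\<lambda>_ _. 0) \<in> strategy_profiles n" by (auto simp: strategy_profiles_def)
  then show ?thesis
    unfolding OPT_def using social_cost_ge assms finite_strategy_profiles
    by (subst Min_ge_iff) auto
qed

text \<open>For the players of the cycle and the leaves of the star this settles all deviations that
  request some link, so that only the empty row is left.\<close>

lemma individual_cost_ge_link:
  assumes "S \<in> strategy_profiles n" "S v w = 1" "\<alpha> > 0"
  shows "ereal \<alpha> \<le> individual_cost n \<alpha> A S v"
proof -
  have "w \<in> players n" using assms by (auto simp: strategy_profiles_def)
  then have "real (S v w) \<le> (\<Sum>w\<in>players n. real (S v w))"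
    by (intro member_le_sum) auto
  then have "ereal \<alpha> + 0 \<le> individual_cost n \<alpha> A S v"
    unfolding individual_cost_def using assms
    by (intro add_mono disconnection_cost_nonneg) auto
  then show ?thesis by simp
qed

text \<open>One equilibrium bounds the minimum from above, and \<open>q\<close> bounds the optimum
  from below. As the optimum is positive and finite, the quotient of extended reals behaves like a
  real one.\<close>

lemma price_of_stability_le:
  assumes "S \<in> NE n \<alpha> A" "social_cost n \<alpha> A S \<le> ereal (c * q)" "ereal q \<le> OPT n \<alpha> A"
    "n \<ge> 2" "\<alpha> > 0" "c \<ge> 0"
  shows "price_of_stability n \<alpha> A \<le> ereal c"
proof -
  obtain o' where o': "OPT n \<alpha> A = ereal o'" "o' > 0"
    using OPT_pos_finite[OF assms(4,5), of A] by (cases "OPT n \<alpha> A") auto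
  have "Min (social_cost n \<alpha> A ` NE n \<alpha> A) \<le> social_cost n \<alpha> A S"
    using assms(1) finite_NE by (intro Min_le) auto
  also have "\<dots> \<le> ereal (c * q)" by fact
  also have "\<dots> \<le> ereal (c * o')" using assms o' by (simp add: mult_left_mono)
  finally have "price_of_stability n \<alpha> A \<le> ereal (c * o') / ereal o'"
    unfolding price_of_stability_def o' using o' by (intro ereal_divide_right_mono) auto
  then show ?thesis using o' by simp
qed

section \<open>Paths\<close>

text \<open>A path is given by an enumeration of its vertices, since the paths that arise when
  different players drop their edge of the cycle differ only in this order.\<close>

definition path_edges :: "nat \<Rightarrow> (nat \<Rightarrow> 'a) \<Rightarrow> 'a set set" where
  "path_edges n f = {{f i, f (Suc i)} | i. Suc i < n}"

lemma connected_graph_path: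
  assumes "bij_betw f {..<n} V"
  shows "connected_graph V (path_edges n f)"
  unfolding connected_graph_iff_crossed
proof (intro allI impI, rule ccontr)
  fix X assume X: "X \<subseteq> V \<and> X \<noteq> {} \<and> X \<noteq> V" and "\<not> crossed V (path_edges n f) X"
  have V: "f i \<in> V" if "i < n" for i using assms that by (auto simp: bij_betw_def)
  have step: "f i \<in> X \<longleftrightarrow> f (Suc i) \<in> X" if "Suc i < n" for i
  proof -
    have "{f i, f (Suc i)} \<in> path_edges n f" "{f (Suc i), f i} \<in> path_edges n f"
      using that by (auto simp: path_edges_def)
    with \<open>\<not> crossed V (path_edges n f) X\<close> V[of i] V[of "Suc i"] that show ?thesis
      unfolding crossed_def by (meson DiffI Suc_lessD)
  qed
  have "f i \<in> X \<longleftrightarrow> f 0 \<in> X" if "i < n" for i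
    using that by (induction i) (auto simp: step)
  moreover have "V = f ` {..<n}" using assms by (simp add: bij_betw_def)
  ultimately show False using X by blast
qed

lemma path_edge_iff:
  assumes "inj_on f {..<n}" "i < n" "j < n"
  shows "{f i, f j} \<in> path_edges n f \<longleftrightarrow> i = Suc j \<or> j = Suc i"
proof
  assume "{f i, f j} \<in> path_edges n f"
  then obtain k where k: "Suc k < n" "{f i, f j} = {f k, f (Suc k)}"
    by (auto simp: path_edges_def)
  then have "i = k \<and> j = Suc k \<or> i = Suc k \<and> j = k"
    using assms by (auto simp: doubleton_eq_iff inj_on_eq_iff)
  then show "i = Suc j \<or> j = Suc i" by auto
qed (use assms in \<open>auto simp: path_edges_def doubleton_eq_iff\<close>)

text \<open>Removing the edge splits the path into \<open>Suc i\<close> and \<open>n - Suc i\<close>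
  vertices with one end on each side, and each end loses the side of the other.\<close>

lemma relevance_path_ends:
  assumes f: "bij_betw f {..<n} V" and i: "Suc i < n"
  defines "e \<equiv> {f i, f (Suc i)}"
  shows "n \<le> relevance V (path_edges n f) e (f 0) + relevance V (path_edges n f) e (f (n - 1))"
proof -
  have inj: "inj_on f {..<n}" and V: "V = f ` {..<n}" using f by (auto simp: bij_betw_def)
  let ?X = "f ` {..i}"
  have VX: "V - ?X = f ` {Suc i..<n}"
  proof -
    have "V - ?X = f ` ({..<n} - {..i})"
      using inj i unfolding V by (subst inj_on_image_set_diff[OF inj]) auto
    also have "{..<n} - {..i} = {Suc i..<n}" by auto
    finally show ?thesis .
  qed
  have cX: "card ?X = Suc i" using i by (subst card_image) (auto intro: inj_on_subset[OF inj])
  have cVX: "card (V - ?X) = n - Suc i"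
    unfolding VX by (subst card_image) (auto intro: inj_on_subset[OF inj])
  have fin: "finite V" using V by simp
  have cut: "{a, b} = e" if "a \<in> ?X" "b \<in> V - ?X" "{a, b} \<in> path_edges n f" for a b
  proof -
    from that VX obtain j k where jk: "a = f j" "j \<le> i" "b = f k" "Suc i \<le> k" "k < n" by auto
    with that(3) path_edge_iff[OF inj, of j k] have "j = i \<and> k = Suc i" by auto
    with jk show ?thesis by (simp add: e_def)
  qed
  have "card (V - ?X) \<le> relevance V (path_edges n f) e (f 0)"
    by (rule relevance_ge_cut[OF fin]) (use cut in auto)
  moreover have "card (V - (V - ?X)) \<le> relevance V (path_edges n f) e (f (n - 1))"
  proof (rule relevance_ge_cut[OF fin])
    show "f (n - 1) \<in> V - ?X" unfolding VX using i by auto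
    fix a b assume "a \<in> V - ?X" "b \<in> V - (V - ?X)" "{a, b} \<in> path_edges n f"
    with cut[of b a] show "{a, b} = e" by (auto simp: insert_commute)
  qed
  moreover have "?X \<subseteq> V" unfolding V using i by (intro image_mono) auto
  then have "V - (V - ?X) = ?X" by (simp add: double_diff)
  ultimately show ?thesis using cX cVX by simp
qed

text \<open>The reflection sends \<open>f i\<close> to \<open>f (n - 1 - i)\<close>, which preserves
  the relation of having consecutive indices.\<close>

lemma graph_automorphism_path_reflection:
  assumes f: "bij_betw f {..<n} V" and n: "n \<ge> 1"
  obtains \<phi> where "graph_automorphism V (path_edges n f) \<phi>" "\<phi> (f (n - 1)) = f 0"
proof
  let ?g = "inv_into {..<n} f"
  let ?\<phi> = "\<lambda>x. f (n - 1 - ?g x)"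
  have inj: "inj_on f {..<n}" and V: "V = f ` {..<n}" using f by (auto simp: bij_betw_def)
  have \<phi>: "?\<phi> (f i) = f (n - 1 - i)" if "i < n" for i using inj that by simp
  have "bij_betw (\<lambda>i. n - 1 - i) {..<n} {..<n}"
    by (rule bij_betw_byWitness[where f' = "\<lambda>i. n - 1 - i"]) auto
  then have "bij_betw (f \<circ> (\<lambda>i. n - 1 - i) \<circ> ?g) V V"
    using f bij_betw_inv_into[OF f] by (meson bij_betw_trans)
  then have "bij_betw ?\<phi> V V" by (simp add: o_def)
  moreover have "{v, w} \<in> path_edges n f \<longleftrightarrow> {?\<phi> v, ?\<phi> w} \<in> path_edges n f"
    if "v \<in> V" "w \<in> V" for v w
  proof -
    from that V obtain i j where ij: "v = f i" "i < n" "w = f j" "j < n" by auto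
    have "{f i, f j} \<in> path_edges n f \<longleftrightarrow> i = Suc j \<or> j = Suc i"
      using path_edge_iff[OF inj] ij by simp
    also have "\<dots> \<longleftrightarrow> n - 1 - i = Suc (n - 1 - j) \<or> n - 1 - j = Suc (n - 1 - i)"
      using ij by auto
    also have "\<dots> \<longleftrightarrow> {f (n - 1 - i), f (n - 1 - j)} \<in> path_edges n f"
      using path_edge_iff[OF inj, of "n - 1 - i" "n - 1 - j"] ij by auto
    finally show ?thesis using ij \<phi> by simp
  qed
  ultimately show "graph_automorphism V (path_edges n f) ?\<phi>" by (simp add: graph_automorphism_def)
  show "?\<phi> (f (n - 1)) = f 0" using \<phi>[of "n - 1"] n by simp
qed

text \<open>For each attacked edge the relevances for the two ends add up to at least
  \<open>n\<close>, hence so do the two disconnection costs. Reflection and anonymity make these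
  costs equal.\<close>

lemma disconnection_cost_path_end:
  assumes "anonymous n A" "adversary n A" "S \<in> essential_profiles n" "n \<ge> 2"
    and f: "bij_betw f {..<n} (players n)" and E: "final_graph n S = path_edges n f"
  shows "ereal (real n / 2) \<le> disconnection_cost n A (final_graph n S) (f (n - 1))"
proof -
  let ?E = "path_edges n f" and ?V = "players n"
  let ?P = "\<lambda>e. measure_pmf.prob (A ?E) {e}"
  let ?I = "\<lambda>v. \<Sum>e\<in>?E. real (relevance ?V ?E e v) * ?P e"
  have conn: "connected_graph ?V ?E" using f by (rule connected_graph_path)
  obtain \<phi> where \<phi>: "graph_automorphism ?V ?E \<phi>" "\<phi> (f (n - 1)) = f 0"
    using graph_automorphism_path_reflection[OF f] assms(4) by auto
  have "f (n - 1) \<in> ?V" using f assms(4) by (auto simp: bij_betw_def)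
  then have "disconnection_cost n A ?E (f (n - 1)) = disconnection_cost n A ?E (f 0)"
    using assms(1,3) \<phi>(1) unfolding anonymous_def \<phi>(2)[symmetric] by (simp flip: E)
  then have sym: "?I (f (n - 1)) = ?I (f 0)"
    using conn by (simp add: disconnection_cost_def)
  \<comment> \<open>The probabilities sum to 1, so \<open>n\<close> is itself an average over the
    edges and can be compared edge by edge.\<close>
  have "real n = (\<Sum>e\<in>?E. real n * ?P e)"
    using sum_adversary_prob[OF assms(2), of ?E] connected_graph_nonempty[OF conn assms(4)]
      final_graph_subset[of n S] E by (simp flip: sum_distrib_left)
  also have "\<dots> \<le> (\<Sum>e\<in>?E. (real (relevance ?V ?E e (f 0))
      + real (relevance ?V ?E e (f (n - 1)))) * ?P e)"
  proof (intro sum_mono mult_right_mono)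
    fix e assume "e \<in> ?E"
    then obtain i where "Suc i < n" "e = {f i, f (Suc i)}" by (auto simp: path_edges_def)
    then show "real n \<le> real (relevance ?V ?E e (f 0)) + real (relevance ?V ?E e (f (n - 1)))"
      using relevance_path_ends[OF f, of i] by (simp flip: of_nat_add)
  qed auto
  also have "\<dots> = ?I (f 0) + ?I (f (n - 1))" by (simp add: distrib_right sum.distrib)
  finally have "real n / 2 \<le> ?I (f (n - 1))" using sym by simp
  then show ?thesis using conn by (simp add: E disconnection_cost_def)
qed

section \<open>The cycle\<close>

definition cycle_profile :: "nat \<Rightarrow> nat \<Rightarrow> nat \<Rightarrow> nat" where
  "cycle_profile n v w = of_bool (v \<in> players n \<and> w = (if v = n then 1 else Suc v))"

lemma cycle_profile_iff:
  "cycle_profile n v w = 1 \<longleftrightarrow> v \<in> players n \<and> w = (if v = n then 1 else Suc v)"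
  unfolding cycle_profile_def of_bool_eq_1_iff ..

text \<open>From \<open>n = 3\<close> on a player is not the successor of her own successor, so no
  edge is requested from both ends.\<close>

lemma cycle_profile_essential:
  assumes "n \<ge> 3"
  shows "cycle_profile n \<in> essential_profiles n"
proof -
  have 1: "v \<in> players n \<and> w \<in> players n \<and> v \<noteq> w" and 2: "cycle_profile n w v \<noteq> 1"
    if "cycle_profile n v w = 1" for v w
    using that assms unfolding cycle_profile_iff by (auto simp: players_def split: if_splits)
  have 3: "cycle_profile n v w \<in> {0, 1}" for v w by (simp add: cycle_profile_def)
  have "cycle_profile n w v = 0" if "cycle_profile n v w = 1" for v w
    using 2[OF that] 3[of w v] by blast
  with 1 3 show ?thesis unfolding essential_profiles_def strategy_profiles_def by blast
qed

text \<open>The enumeration of the cycle that starts at the successor of \<open>v\<close> and ends at \<open>v\<close>.\<close>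

definition cycle_order :: "nat \<Rightarrow> nat \<Rightarrow> nat \<Rightarrow> nat" where
  "cycle_order n v i = (if v + i < n then Suc (v + i) else Suc (v + i) - n)"

lemma bij_cycle_order:
  assumes "v \<in> players n"
  shows "bij_betw (cycle_order n v) {..<n} (players n)"
  using assms
  \<comment> \<open>The inverse counts the steps from the successor of \<open>v\<close> to
    \<open>w\<close>; for \<open>w \<le> v\<close> the count wraps around, which adds
    \<open>n\<close>.\<close>
  by (intro bij_betw_byWitness[where f' = "\<lambda>w. if v < w then w - Suc v else w + n - Suc v"])
     (auto simp: cycle_order_def players_def split: if_splits)

lemma cycle_order_last: "v \<in> players n \<Longrightarrow> cycle_order n v (n - 1) = v"
  by (auto simp: cycle_order_def players_def)

text \<open>Anonymity speaks only of final graphs of essential profiles. It can be applied after a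
  player has dropped all her links because the profile stays essential.\<close>

lemma drop_row_essential:
  assumes "S \<in> essential_profiles n"
  shows "S(v := (\<lambda>_. 0)) \<in> essential_profiles n"
proof -
  let ?T = "S(v := (\<lambda>_. 0))"
  have T: "?T a b = (if a = v then 0 else S a b)" for a b by simp
  have S: "S \<in> strategy_profiles n" "S a b = 1 \<Longrightarrow> S b a = 0" for a b
    using assms unfolding essential_profiles_def by blast+
  have "?T a b \<in> {0, 1}" for a b
    unfolding T using strategy_profileD(1)[OF S(1), of a b] by auto
  moreover have "a \<in> players n \<and> b \<in> players n \<and> a \<noteq> b \<and> ?T b a = 0" if "?T a b = 1" for a b
    using that strategy_profileD(2)[OF S(1), of a b] S(2)[of a b] unfolding T
    by (cases "a = v") simp_all
  ultimately show ?thesis unfolding essential_profiles_def strategy_profiles_def by blast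
qed

lemma strategy_profile_row:
  assumes "S(v := r) \<in> strategy_profiles n"
  shows "r w \<in> {0, 1}" "r w = 1 \<Longrightarrow> w \<in> players n \<and> w \<noteq> v"
  using strategy_profileD[OF assms, of v w] by simp_all

lemma final_graph_eq:
  assumes "S \<in> strategy_profiles n"
  shows "final_graph n S = {{v, w} | v w. S v w = 1}"
proof
  show "final_graph n S \<subseteq> {{v, w} | v w. S v w = 1}"
    unfolding final_graph_def using insert_commute by blast
  show "{{v, w} | v w. S v w = 1} \<subseteq> final_graph n S"
    unfolding final_graph_def using strategy_profileD(2)[OF assms] by blast
qed

text \<open>The remaining requests lead from each player other than \<open>v\<close> to her
  successor, and these are the consecutive pairs in the order that ends at \<open>v\<close>.\<close>

lemma final_graph_cycle_drop:
  assumes "n \<ge> 3" "v \<in> players n"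
  shows "final_graph n ((cycle_profile n)(v := (\<lambda>_. 0))) = path_edges n (cycle_order n v)"
proof -
  let ?S = "(cycle_profile n)(v := (\<lambda>_. 0))" and ?f = "cycle_order n v"
  have S: "?S \<in> strategy_profiles n"
    using drop_row_essential[OF cycle_profile_essential[OF assms(1)]]
    by (auto simp: essential_profiles_def)
  have T: "?S a b = 1 \<longleftrightarrow> a \<noteq> v \<and> a \<in> players n \<and> b = (if a = n then 1 else Suc a)" for a b
    using cycle_profile_iff[of n a b] by (cases "a = v") simp_all
  have "?S a b = 1 \<longleftrightarrow> (\<exists>i. Suc i < n \<and> a = ?f i \<and> b = ?f (Suc i))" for a b
    unfolding T
  proof
    assume a: "a \<noteq> v \<and> a \<in> players n \<and> b = (if a = n then 1 else Suc a)"
    \<comment> \<open>The position of \<open>a\<close> in the order; it is not the last one because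
      \<open>a \<noteq> v\<close>.\<close>
    define i where "i = (if v < a then a - Suc v else a + n - Suc v)"
    have "Suc i < n \<and> a = ?f i \<and> b = ?f (Suc i)"
      using a assms by (auto simp: i_def cycle_order_def players_def)
    then show "\<exists>i. Suc i < n \<and> a = ?f i \<and> b = ?f (Suc i)" by blast
  next
    assume "\<exists>i. Suc i < n \<and> a = ?f i \<and> b = ?f (Suc i)"
    then obtain i where i: "Suc i < n" "a = ?f i" "b = ?f (Suc i)" by blast
    \<comment> \<open>Position \<open>i\<close> lies either before or after the wrap from
      \<open>n\<close> to \<open>1\<close>.\<close>
    consider "v + i < n" | "n \<le> v + i" by linarith
    then show "a \<noteq> v \<and> a \<in> players n \<and> b = (if a = n then 1 else Suc a)"
      by cases (use i assms in \<open>simp_all add: cycle_order_def players_def\<close>, linarith+)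
  qed
  then show ?thesis unfolding final_graph_eq[OF S] path_edges_def by simp blast
qed

text \<open>An edge of the cycle is requested by one player only, so dropping her row leaves a path
  that avoids this edge and still spans all players.\<close>

lemma cycle_connected_minus_edge:
  assumes "n \<ge> 3" "e \<in> final_graph n (cycle_profile n)"
  shows "connected_graph (players n) (final_graph n (cycle_profile n) - {e})"
proof -
  let ?S = "cycle_profile n"
  have S: "?S \<in> essential_profiles n" by (rule cycle_profile_essential) fact
  then have S': "?S \<in> strategy_profiles n" by (simp add: essential_profiles_def)
  from assms(2) obtain v w where vw: "e = {v, w}" "?S v w = 1"
    unfolding final_graph_eq[OF S'] by blast
  then have v: "v \<in> players n" by (simp only: cycle_profile_iff)
  let ?T = "?S(v := (\<lambda>_. 0))"
  have T: "?T \<in> strategy_profiles n"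
    using drop_row_essential[OF S] by (auto simp: essential_profiles_def)
  have "final_graph n ?T \<subseteq> final_graph n ?S - {e}"
  proof
    fix d assume "d \<in> final_graph n ?T"
    then obtain a b where ab: "d = {a, b}" "?T a b = 1"
      unfolding final_graph_eq[OF T] by blast
    then have "a \<noteq> v" "?S a b = 1" by (auto split: if_splits)
    moreover have "?S w v = 0" using S vw by (simp add: essential_profiles_def)
    ultimately show "d \<in> final_graph n ?S - {e}"
      unfolding final_graph_eq[OF S'] using ab vw by (auto simp: doubleton_eq_iff)
  qed
  moreover have "connected_graph (players n) (final_graph n ?T)"
    unfolding final_graph_cycle_drop[OF assms(1) v]
    by (rule connected_graph_path[OF bij_cycle_order[OF v]])
  ultimately show ?thesis by (rule connected_graph_mono[rotated])
qed

lemma cycle_connected: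
  assumes "n \<ge> 3"
  shows "connected_graph (players n) (final_graph n (cycle_profile n))"
proof (cases "final_graph n (cycle_profile n) = {}")
  case True
  have "cycle_profile n 1 2 = 1" using assms by (simp add: cycle_profile_def players_def)
  then have "{1, 2} \<in> final_graph n (cycle_profile n)"
    using cycle_profile_essential[OF assms] final_graph_eq[of "cycle_profile n" n]
    by (auto simp: essential_profiles_def)
  with True show ?thesis by simp
next
  case False
  then show ?thesis
    using cycle_connected_minus_edge[OF assms] connected_graph_mono by (metis Diff_subset ex_in_conv)
qed

lemma cycle_row_sum:
  assumes "n \<ge> 3" "v \<in> players n"
  shows "(\<Sum>w\<in>players n. cycle_profile n v w) = 1"
proof -
  let ?s = "if v = n then 1 else Suc v"
  have "?s \<in> players n" using assms by (auto simp: players_def)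
  moreover have "(\<Sum>w\<in>players n. cycle_profile n v w) = (\<Sum>w\<in>players n. if w = ?s then 1 else 0)"
    using assms by (intro sum.cong) (auto simp: cycle_profile_def)
  ultimately show ?thesis by simp
qed

text \<open>The cycle has no bridge, so all relevances vanish wherever the adversary
  strikes.\<close>

lemma disconnection_cost_cycle:
  assumes "n \<ge> 3" "v \<in> players n"
  shows "disconnection_cost n A (final_graph n (cycle_profile n)) v = 0"
  using cycle_connected[OF assms(1)] cycle_connected_minus_edge[OF assms(1)] assms(2)
  by (simp add: disconnection_cost_def relevance_eq_0)

lemma individual_cost_cycle:
  assumes "n \<ge> 3" "v \<in> players n"
  shows "individual_cost n \<alpha> A (cycle_profile n) v = ereal \<alpha>"
  using cycle_row_sum[OF assms] disconnection_cost_cycle[OF assms]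
  by (simp add: individual_cost_def flip: of_nat_sum)

lemma social_cost_cycle:
  "n \<ge> 3 \<Longrightarrow> social_cost n \<alpha> A (cycle_profile n) = ereal (real n * \<alpha>)"
  by (simp add: social_cost_def individual_cost_cycle)

text \<open>Every player pays exactly \<alpha>. A deviation with some link costs at least as much,
  and the empty row turns the player into the end of a path, where disconnection alone costs at
  least \<open>n / 2 \<ge> \<alpha>\<close>.\<close>

lemma cycle_NE:
  assumes "anonymous n A" "adversary n A" "n \<ge> 3" "0 < \<alpha>" "\<alpha> \<le> real n / 2"
  shows "cycle_profile n \<in> NE n \<alpha> A"
  unfolding NE_def
proof (intro CollectI conjI ballI allI impI)
  let ?S = "cycle_profile n"
  show S: "?S \<in> essential_profiles n" using assms by (intro cycle_profile_essential)
  fix v r assume v: "v \<in> players n" and r: "?S(v := r) \<in> strategy_profiles n"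
  have "ereal \<alpha> \<le> individual_cost n \<alpha> A (?S(v := r)) v"
  proof (cases "\<exists>w. r w = 1")
    case True
    then show ?thesis using individual_cost_ge_link[OF r] assms(4) by auto
  next
    case False
    then have "r w = 0" for w using strategy_profile_row(1)[OF r, of w] by auto
    then have r0: "r = (\<lambda>_. 0)" by (rule ext)
    have "ereal (real n / 2) \<le> disconnection_cost n A (final_graph n (?S(v := r))) v"
      using disconnection_cost_path_end[OF assms(1,2) drop_row_essential[OF S]
          _ bij_cycle_order[OF v] final_graph_cycle_drop[OF assms(3) v]] assms(3)
      unfolding cycle_order_last[OF v] r0 by simp
    then show ?thesis
      using assms(5) order_trans[of "ereal \<alpha>" "ereal (real n / 2)"]
      by (simp add: individual_cost_def r0 flip: zero_ereal_def)
  qed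
  then show "\<not> individual_cost n \<alpha> A (?S(v := r)) v < individual_cost n \<alpha> A ?S v"
    using individual_cost_cycle v assms(3) by (simp add: not_less)
qed

section \<open>The star\<close>

text \<open>All links are bought by the center \<open>1\<close>, so a leaf pays for none and can
  only add some.\<close>

definition star_profile :: "nat \<Rightarrow> nat \<Rightarrow> nat \<Rightarrow> nat" where
  "star_profile n v w = of_bool (v = 1 \<and> w \<in> {2..n})"

lemma star_profile_essential: "star_profile n \<in> essential_profiles n"
  by (auto simp: star_profile_def essential_profiles_def strategy_profiles_def players_def)

lemma final_graph_star: "final_graph n (star_profile n) = {{1, w} | w. w \<in> {2..n}}"
  using star_profile_essential[of n] final_graph_eq[of "star_profile n" n]
  by (auto simp: essential_profiles_def star_profile_def)

lemma star_edge_iff: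
  "{v, w} \<in> final_graph n (star_profile n) \<longleftrightarrow> v = 1 \<and> w \<in> {2..n} \<or> w = 1 \<and> v \<in> {2..n}"
  by (auto simp: final_graph_star doubleton_eq_iff)

text \<open>The walk through the center uses at most the edges at its own two ends; such explicit
  walks bound the relevance from above.\<close>

lemma star_walk:
  assumes "v \<in> players n" "w \<in> players n"
  obtains p where "walk_betw (players n) (final_graph n (star_profile n)) v p w"
    "\<And>x. {1, x} \<in> set (walk_edges p) \<Longrightarrow> x = v \<or> x = w" "v = w \<Longrightarrow> walk_edges p = []"
proof
  define p where "p = (if v = w then [v] else if v = 1 then [1, w] else if w = 1 then [v, 1]
                       else [v, 1, w])"
  show "walk_betw (players n) (final_graph n (star_profile n)) v p w"
    using assms by (auto simp: p_def walk_betw_def star_edge_iff players_def)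
  show "x = v \<or> x = w" if "{1, x} \<in> set (walk_edges p)" for x
    using that by (auto simp: p_def doubleton_eq_iff split: if_splits)
  show "v = w \<Longrightarrow> walk_edges p = []" by (simp add: p_def)
qed

lemma star_connected: "connected_graph (players n) (final_graph n (star_profile n))"
  unfolding connected_graph_def using star_walk by meson

text \<open>Losing the edge costs the leaf \<open>x\<close> the \<open>n - 1\<close> other vertices,
  and every other vertex only \<open>x\<close>.\<close>

lemma sum_relevance_star:
  assumes "x \<in> {2..n}"
  shows "(\<Sum>v\<in>players n. relevance (players n) (final_graph n (star_profile n)) {1, x} v)
    \<le> 2 * (n - 1)"
proof -
  let ?V = "players n" and ?E = "final_graph n (star_profile n)"
  let ?R = "\<lambda>v. {w \<in> ?V. \<forall>p. walk_betw ?V ?E v p w \<longrightarrow> {1, x} \<in> set (walk_edges p)}"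
  have x: "x \<in> ?V" using assms by (auto simp: players_def)
  have R: "?R v \<subseteq> (if v = x then ?V - {x} else {x})" if v: "v \<in> ?V" for v
  proof
    fix w assume w: "w \<in> ?R v"
    obtain p where "walk_betw ?V ?E v p w" "\<And>y. {1, y} \<in> set (walk_edges p) \<Longrightarrow> y = v \<or> y = w"
      "v = w \<Longrightarrow> walk_edges p = []"
      using star_walk[OF v, of w] w by blast
    with w have "w \<in> ?V" "v \<noteq> w" "x = v \<or> x = w" by (blast, fastforce, blast)
    then show "w \<in> (if v = x then ?V - {x} else {x})" by auto
  qed
  have "relevance ?V ?E {1, x} v \<le> (if v = x then n - 1 else 1)" if "v \<in> ?V" for v
    using card_mono[OF _ R[OF that]] x by (auto simp: relevance_def split: if_splits)
  then have "(\<Sum>v\<in>?V. relevance ?V ?E {1, x} v) \<le> (\<Sum>v\<in>?V. if v = x then n - 1 else 1)"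
    by (intro sum_mono)
  also have "\<dots> = (n - 1) + (\<Sum>v\<in>?V - {x}. 1)"
    using x by (subst sum.remove[of _ x]) auto
  also have "\<dots> = 2 * (n - 1)" using x by simp
  finally show ?thesis .
qed

text \<open>The bound matches \<open>total_disconnection_tree\<close>: against the same adversary,
  no graph with \<open>n - 1\<close> edges does better than the star.\<close>

lemma total_disconnection_star:
  assumes "adversary n A" "n \<ge> 2"
  shows "total_disconnection n A (final_graph n (star_profile n)) \<le> 2 * (real n - 1)"
proof -
  let ?E = "final_graph n (star_profile n)"
  have "total_disconnection n A ?E \<le> (\<Sum>e\<in>?E. 2 * (real n - 1) * measure_pmf.prob (A ?E) {e})"
    unfolding total_disconnection_def
  proof (intro sum_mono mult_right_mono)
    fix e assume "e \<in> ?E"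
    then have "(\<Sum>v\<in>players n. relevance (players n) ?E e v) \<le> 2 * (n - 1)"
      using sum_relevance_star by (auto simp: final_graph_star)
    then have "real (\<Sum>v\<in>players n. relevance (players n) ?E e v) \<le> real (2 * (n - 1))"
      by (simp only: of_nat_le_iff)
    then show "real (\<Sum>v\<in>players n. relevance (players n) ?E e v) \<le> 2 * (real n - 1)"
      using assms by (simp add: of_nat_diff)
  qed auto
  also have "\<dots> = 2 * (real n - 1)"
    using sum_adversary_prob[OF assms(1) final_graph_subset]
      connected_graph_nonempty[OF star_connected assms(2)] by (simp flip: sum_distrib_left)
  finally show ?thesis .
qed

lemma graph_automorphism_star:
  assumes "x \<in> {2..n}" "y \<in> {2..n}"
  shows "graph_automorphism (players n) (final_graph n (star_profile n)) (Transposition.transpose x y)"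
proof -
  have "bij_betw (Transposition.transpose x y) (players n) (players n)"
    using assms by (auto simp: players_def)
  then show ?thesis
    using assms unfolding graph_automorphism_def star_edge_iff
    by (auto simp: Transposition.transpose_def)
qed

text \<open>Exchanging two leaves is an automorphism, so all \<open>n - 1\<close> leaves bear the
  same cost. Together they bear at most the total \<open>2 * (n - 1)\<close>.\<close>

lemma disconnection_cost_star_leaf:
  assumes "anonymous n A" "adversary n A" "x \<in> {2..n}"
  shows "disconnection_cost n A (final_graph n (star_profile n)) x \<le> 2"
proof -
  let ?E = "final_graph n (star_profile n)"
  let ?I = "disconnection_cost n A ?E"
  have n: "n \<ge> 2" using assms by auto
  obtain c where c: "?I x = ereal c"
    using star_connected by (simp add: disconnection_cost_def)
  have "x \<in> players n" using assms(3) by (auto simp: players_def)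
  then have "?I x = ?I (Transposition.transpose x y x)" if "y \<in> {2..n}" for y
    using assms(1) graph_automorphism_star[OF assms(3) that] star_profile_essential
    unfolding anonymous_def by blast
  then have "?I y = ereal c" if "y \<in> {2..n}" for y using c that by simp
  then have "(\<Sum>y\<in>{2..n}. ?I y) = ereal ((real n - 1) * c)"
    using n by (simp add: of_nat_diff)
  \<comment> \<open>The cost of the center is nonnegative and can be left out.\<close>
  moreover have "(\<Sum>y\<in>{2..n}. ?I y) \<le> (\<Sum>y\<in>players n. ?I y)"
    by (intro sum_mono2) (auto simp: players_def disconnection_cost_nonneg)
  ultimately have "(real n - 1) * c \<le> (real n - 1) * 2"
    using total_disconnection_star[OF assms(2) n] sum_disconnection_cost[OF star_connected]
    by (simp add: mult.commute)
  then have "c \<le> 2" using n by (subst (asm) mult_le_cancel_left_pos) auto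
  then show ?thesis using c by simp
qed

text \<open>The center cannot omit a leaf without disconnecting the graph and has no further link to
  add. A leaf pays at most 2 now, and at least \<alpha> after requesting any link.\<close>

lemma star_NE:
  assumes "anonymous n A" "adversary n A" "n \<ge> 2" "\<alpha> \<ge> 2"
  shows "star_profile n \<in> NE n \<alpha> A"
  unfolding NE_def
proof (intro CollectI conjI ballI allI impI)
  let ?S = "star_profile n"
  show "?S \<in> essential_profiles n" by (rule star_profile_essential)
  fix v r assume v: "v \<in> players n" and r: "?S(v := r) \<in> strategy_profiles n"
  let ?T = "?S(v := r)"
  note r01 = strategy_profile_row(1)[OF r] and r1 = strategy_profile_row(2)[OF r]
  have "individual_cost n \<alpha> A ?S v \<le> individual_cost n \<alpha> A ?T v"
  proof (cases "v = 1")
    case True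
    show ?thesis
    proof (cases "\<exists>w\<in>{2..n}. r w = 0")
      case True
      then obtain w where w: "w \<in> {2..n}" "r w = 0" by blast
      \<comment> \<open>No leaf requests a link, so \<open>w\<close> is isolated once the center
        omits her.\<close>
      have "{w, b} \<notin> final_graph n ?T" for b
        unfolding final_graph_eq[OF r] using w \<open>v = 1\<close>
        by (auto simp: star_profile_def doubleton_eq_iff)
      then have "\<not> crossed (players n) (final_graph n ?T) {w}" by (simp add: crossed_def)
      moreover have "{w} \<subseteq> players n" using w by (auto simp: players_def)
      moreover have "v \<noteq> w" using w \<open>v = 1\<close> by auto
      then have "{w} \<noteq> players n" using v by blast
      ultimately have "\<not> connected_graph (players n) (final_graph n ?T)"
        unfolding connected_graph_iff_crossed by blast
      then show ?thesis by (simp add: individual_cost_def disconnection_cost_def)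
    next
      case False
      then have nz: "r w \<noteq> 0" if "w \<in> {2..n}" for w
        using that by (metis (full_types))
      have "r w = ?S 1 w" for w
        using nz[of w] r01[of w] r1[of w] \<open>v = 1\<close>
        by (cases "w \<in> {2..n}") (auto simp: star_profile_def players_def)
      then have "?T = ?S" using True by (auto simp: fun_eq_iff)
      then show ?thesis by simp
    qed
  next
    case False
    then have leaf: "v \<in> {2..n}" using v by (auto simp: players_def)
    show ?thesis
    proof (cases "\<exists>w. r w = 1")
      case True
      have "individual_cost n \<alpha> A ?S v = disconnection_cost n A (final_graph n ?S) v"
        using False by (simp add: individual_cost_def star_profile_def flip: zero_ereal_def)
      also have "\<dots> \<le> 2" by (rule disconnection_cost_star_leaf) fact+
      also have "\<dots> \<le> ereal \<alpha>" using assms(4) by simp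
      also have "\<dots> \<le> individual_cost n \<alpha> A ?T v"
        using individual_cost_ge_link[OF r] True assms(4) by auto
      finally show ?thesis .
    next
      case False
      then have "r w = ?S v w" for w using r01[of w] leaf by (auto simp: star_profile_def)
      then have "r = ?S v" by (rule ext)
      then show ?thesis by simp
    qed
  qed
  then show "\<not> individual_cost n \<alpha> A ?T v < individual_cost n \<alpha> A ?S v" by (simp add: not_less)
qed

lemma social_cost_star:
  assumes "adversary n A" "n \<ge> 2"
  shows "social_cost n \<alpha> A (star_profile n) \<le> ereal ((real n - 1) * (\<alpha> + 2))"
proof -
  have "(\<Sum>w\<in>players n. star_profile n v w) = (if v = 1 then n - 1 else 0)" for v
  proof -
    have "players n \<inter> {2..n} = {2..n}" by (auto simp: players_def)
    then show ?thesis by (auto simp: star_profile_def Int_def)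
  qed
  then have "(\<Sum>v\<in>players n. \<Sum>w\<in>players n. star_profile n v w) = n - 1"
    using assms(2) by (simp add: players_def)
  then show ?thesis
    using total_disconnection_star[OF assms] assms(2)
    by (simp add: social_cost_eq[OF star_connected] of_nat_diff algebra_simps)
qed

section \<open>The price of stability\<close>

text \<open>Nonemptiness of \<open>NE\<close> is part of the claim because the minimum over an empty
  set of equilibria would be a default value.\<close>

lemma price_of_stability_bound:
  assumes "n \<ge> 9" "\<alpha> > 0" "adversary n A" "anonymous n A"
  shows "NE n \<alpha> A \<noteq> {} \<and> price_of_stability n \<alpha> A \<le> ereal (1 + 8 / (real n - 2))"
proof -
  \<comment> \<open>The first term of \<open>?q\<close> is the cost of the cycle, the second bounds
    the cost of the star, and their minimum bounds the optimum from below.\<close>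
  let ?q = "min (real n * \<alpha>) ((real n - 1) * (\<alpha> + 2))" and ?c = "1 + 8 / (real n - 2)"
  have q: "ereal ?q \<le> OPT n \<alpha> A" using OPT_ge assms by simp
  have n: "n \<ge> 3" "n \<ge> 2" and c: "?c \<ge> 1" using assms by auto
  have q0: "?q \<ge> 0" using assms by simp
  obtain S where S: "S \<in> NE n \<alpha> A" "social_cost n \<alpha> A S \<le> ereal (?c * ?q)"
  proof (cases "\<alpha> \<le> real n / 2")
    case True
    \<comment> \<open>The first term is the smaller one as soon as
      \<open>\<alpha> \<le> 2 * (n - 1)\<close>, so here the cycle attains the lower bound.\<close>
    then have "real n * \<alpha> = ?q" using n by (simp add: min_def algebra_simps)
    then have "real n * \<alpha> \<le> ?c * ?q" using mult_right_mono[OF c q0] by simp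
    then have "social_cost n \<alpha> A (cycle_profile n) \<le> ereal (?c * ?q)"
      by (simp only: social_cost_cycle[OF n(1)] ereal_less_eq)
    with that cycle_NE[OF assms(4,3) n(1) assms(2) True] show ?thesis .
  next
    case False
    then have \<alpha>: "\<alpha> \<ge> 2" using assms by simp
    have "(real n - 1) * (\<alpha> + 2) \<le> ?c * ?q"
    proof (cases "real n * \<alpha> \<le> (real n - 1) * (\<alpha> + 2)")
      case True
      \<comment> \<open>The star may exceed \<open>n * \<alpha>\<close> by
        \<open>2 * (n - 1) - \<alpha>\<close>, which is at most \<open>8 * \<alpha>\<close> because
        \<open>\<alpha> > n / 2\<close>. The fraction \<open>8 / (n - 2)\<close> of
        \<open>n * \<alpha>\<close> covers this excess.\<close>
      have "real n - 2 \<le> real n" "real n - 2 > 0" using n by auto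
      then have "8 / (real n - 2) * (real n * \<alpha>) \<ge> 8 * \<alpha>"
        using \<alpha> by (simp add: field_simps)
      moreover have "(real n - 1) * (\<alpha> + 2) \<le> real n * \<alpha> + 8 * \<alpha>"
        using False \<alpha> by (simp add: algebra_simps)
      ultimately show ?thesis using True by (simp add: min_def distrib_right)
    next
      case False
      then show ?thesis using mult_right_mono[OF c q0] by (simp add: min_def)
    qed
    then have "social_cost n \<alpha> A (star_profile n) \<le> ereal (?c * ?q)"
      using social_cost_star[OF assms(3) n(2), of \<alpha>] order_trans by fastforce
    with that star_NE[OF assms(4,3) n(2) \<alpha>] show ?thesis .
  qed
  then show ?thesis
    using price_of_stability_le[OF S q n(2) assms(2)] c by auto
qed

theorem theorem7p5:
  shows "(\<forall>(n::nat) (\<alpha>::real) (A :: nat set set \<Rightarrow> nat set pmf).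
            n \<ge> 9 \<and> \<alpha> > 0 \<and> adversary n A \<and> anonymous n A \<longrightarrow>
              NE n \<alpha> A \<noteq> {} \<and>
              price_of_stability n \<alpha> A \<le> ereal (1 + 8 / (real n - 2))) \<and>
         (\<lambda>n::nat. 8 / (real n - 2)) \<in> o(\<lambda>_. 1)"
proof (intro conjI allI impI)
  have "(\<lambda>n::nat. 8 / (real n - 2)) \<longlonglongrightarrow> 0" by real_asymp
  then show "(\<lambda>n::nat. 8 / (real n - 2)) \<in> o(\<lambda>_. 1)" by (intro smalloI_tendsto) auto
qed (auto dest: price_of_stability_bound)

end
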